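(* Let $q$ be an odd prime power and $d\ge0$. Let $(\mathbb F_q^{2d},\omega)$ be a symplectic space and let $(\mathbb F_q^{2d+1},Q)$ be a non-degenerate quadratic space of dimension $2d+1$ admitting a $d$-dimensional totally isotropic subspace. Then $$\sum_{F\in\mathcal{WF}(\mathbb F_q^{2d},\omega)}t^{w(F)}=\sum_{F\in\mathcal{WF}(\mathbb F_q^{2d+1},Q)}t^{w(F)}.$$
   Context: For a space $V$ with a non-degenerate symmetric or alternating bilinear form, a subspace is isotropic if the form vanishes identically on it (for the quadratic space, with respect to the associated symmetric bilinear form, equivalently $Q$ vanishes on it since the characteristic is odd). A flag of such a space is a strictly increasing sequence $V_1\subset\dots\subset V_k$ ($k\ge0$) of nonzero isotropic subspaces; a weighted flag additionally carries strictly positive integers $w_1,\dots,w_k$, with weight $w(F)=\sum_i w_i\dim V_i$. $\mathcal{WF}(\cdot)$ denotes the set of weighted flags. *)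

theory Defs
  imports "HOL-Analysis.Analysis" "HOL-Number_Theory.Prime_Powers"
begin

text \<open>
  A vector space over a field \<open>'k\<close> is given by its scalar multiplication \<open>s\<close> on a type \<open>'v\<close>
  (locale \<open>vector_space\<close>).
\<close>

definition bilinear_form ::
    "('k::field \<Rightarrow> 'v::ab_group_add \<Rightarrow> 'v) \<Rightarrow> ('v \<Rightarrow> 'v \<Rightarrow> 'k) \<Rightarrow> bool" where
  "bilinear_form s B \<longleftrightarrow>
     (\<forall>x. Vector_Spaces.linear s (*) (\<lambda>y. B x y)) \<and>
     (\<forall>y. Vector_Spaces.linear s (*) (\<lambda>x. B x y))"

text \<open>
  Only the left radical is required to vanish; for alternating and for symmetric forms it
  coincides with the right radical.
\<close>

definition nondegenerate :: "('v::ab_group_add \<Rightarrow> 'v \<Rightarrow> 'k::field) \<Rightarrow> bool" where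
  "nondegenerate B \<longleftrightarrow> (\<forall>x. (\<forall>y. B x y = 0) \<longrightarrow> x = 0)"

definition symplectic_form ::
    "('k::field \<Rightarrow> 'v::ab_group_add \<Rightarrow> 'v) \<Rightarrow> ('v \<Rightarrow> 'v \<Rightarrow> 'k) \<Rightarrow> bool" where
  "symplectic_form s \<omega> \<longleftrightarrow> bilinear_form s \<omega> \<and> (\<forall>x. \<omega> x x = 0) \<and> nondegenerate \<omega>"

text \<open>
  The symmetric bilinear form associated with a quadratic form is taken without the factor
  \<open>1/2\<close>, so that \<open>polar Q x x = 2 * Q x\<close>. In odd characteristic the factor changes neither
  non-degeneracy nor the isotropic subspaces.
\<close>

definition polar :: "('v::ab_group_add \<Rightarrow> 'k::field) \<Rightarrow> 'v \<Rightarrow> 'v \<Rightarrow> 'k" where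
  "polar Q x y = Q (x + y) - Q x - Q y"

definition quadratic_form ::
    "('k::field \<Rightarrow> 'v::ab_group_add \<Rightarrow> 'v) \<Rightarrow> ('v \<Rightarrow> 'k) \<Rightarrow> bool" where
  "quadratic_form s Q \<longleftrightarrow> (\<forall>c x. Q (s c x) = c\<^sup>2 * Q x) \<and> bilinear_form s (polar Q)"

definition isotropic ::
    "('k::field \<Rightarrow> 'v::ab_group_add \<Rightarrow> 'v) \<Rightarrow> ('v \<Rightarrow> 'v \<Rightarrow> 'k) \<Rightarrow> 'v set \<Rightarrow> bool" where
  "isotropic s B U \<longleftrightarrow> module.subspace s U \<and> (\<forall>x\<in>U. \<forall>y\<in>U. B x y = 0)"

text \<open>
  The weighted flag \<open>V\<^sub>1 \<subset> \<dots> \<subset> V\<^sub>k\<close> with weights \<open>w\<^sub>1, \<dots>, w\<^sub>k\<close> is the list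
  \<open>[(V\<^sub>1, w\<^sub>1), \<dots>, (V\<^sub>k, w\<^sub>k)]\<close>; the case \<open>k = 0\<close> is the empty list.
\<close>

definition weighted_flags ::
    "('k::field \<Rightarrow> 'v::ab_group_add \<Rightarrow> 'v) \<Rightarrow> ('v \<Rightarrow> 'v \<Rightarrow> 'k) \<Rightarrow> ('v set \<times> nat) list set" where
  "weighted_flags s B =
     {F. sorted_wrt (\<subset>) (map fst F) \<and>
         (\<forall>(V, w)\<in>set F. isotropic s B V \<and> V \<noteq> {0} \<and> w > 0)}"

definition flag_weight ::
    "('k::field \<Rightarrow> 'v::ab_group_add \<Rightarrow> 'v) \<Rightarrow> ('v set \<times> nat) list \<Rightarrow> nat" where
  "flag_weight s F = (\<Sum>(V, w)\<leftarrow>F. w * vector_space.dim s V)"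

text \<open>
  The sum of \<open>t ^ w(F)\<close> over all weighted flags, as an infinite sum of formal power series
  in \<open>t\<close>. The lemma \<open>has_sum_weighted_flags\<close> below shows that it converges.
\<close>

definition weighted_flag_series ::
    "('k::field \<Rightarrow> 'v::ab_group_add \<Rightarrow> 'v) \<Rightarrow> ('v \<Rightarrow> 'v \<Rightarrow> 'k) \<Rightarrow> int fps" where
  "weighted_flag_series s B = (\<Sum>\<^sub>\<infinity>F\<in>weighted_flags s B. fps_X ^ flag_weight s F)"

lemma dim_isotropic_pos:
  fixes s :: "'k::field \<Rightarrow> 'v::{ab_group_add, finite} \<Rightarrow> 'v"
  assumes "vector_space s" "isotropic s B V" "V \<noteq> {0}"
  shows "vector_space.dim s V > 0"
proof -
  interpret vector_space s by fact
  have sub: "subspace V"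
    using assms by (simp add: isotropic_def)
  obtain A where A: "A \<subseteq> V" "independent A" "V \<subseteq> span A" "card A = dim V"
    using basis_exists by blast
  have "A \<noteq> {}"
    using A(3) assms(3) subspace_0[OF sub] by auto
  then show ?thesis
    using A(4) by (metis card_gt_0_iff finite)
qed

lemma finite_weighted_flags_weight:
  fixes s :: "'k::field \<Rightarrow> 'v::{ab_group_add, finite} \<Rightarrow> 'v"
  assumes "vector_space s"
  shows "finite {F \<in> weighted_flags s B. flag_weight s F = n}"
proof -
  have bound: "length F \<le> flag_weight s F \<and> (\<forall>(V, w)\<in>set F. w \<le> flag_weight s F)"
    if "\<forall>(V, w)\<in>set F. isotropic s B V \<and> V \<noteq> {0} \<and> w > 0" for F
    using that
  proof (induction F)
    case Nil
    then show ?case by simp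
  next
    case (Cons a F)
    obtain V w where a: "a = (V, w)" by (cases a)
    have IH: "length F \<le> flag_weight s F" "\<forall>(V, w)\<in>set F. w \<le> flag_weight s F"
      using Cons by auto
    have "isotropic s B V" "V \<noteq> {0}" "w > 0"
      using Cons.prems a by simp_all
    then have "vector_space.dim s V > 0"
      using dim_isotropic_pos[OF assms] by blast
    then have "w \<le> w * vector_space.dim s V" by simp
    moreover have "flag_weight s (a # F) = w * vector_space.dim s V + flag_weight s F"
      by (simp add: flag_weight_def a)
    ultimately have "w + flag_weight s F \<le> flag_weight s (a # F)"
      by linarith
    moreover from this have "w' \<le> flag_weight s (a # F)" if "(V', w') \<in> set F" for V' w'
      using IH(2) that by (auto dest!: bspec[where x = "(V', w')"])
    ultimately show ?case
      using IH(1) \<open>w > 0\<close> by (auto simp: a)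
  qed
  have "{F \<in> weighted_flags s B. flag_weight s F = n} \<subseteq>
          {F. set F \<subseteq> UNIV \<times> {..n} \<and> length F \<le> n}"
  proof safe
    fix F and V :: "'v set" and w
    assume F: "F \<in> weighted_flags s B" and n: "n = flag_weight s F"
    then have b: "length F \<le> flag_weight s F" "\<forall>(V, w)\<in>set F. w \<le> flag_weight s F"
      using bound[of F] by (simp_all add: weighted_flags_def)
    show "length F \<le> flag_weight s F" by (rule b(1))
    show "w \<le> flag_weight s F" if "(V, w) \<in> set F"
      using b(2) that by auto
  qed auto
  moreover have "finite {F. set F \<subseteq> (UNIV :: 'v set set) \<times> {..n} \<and> length F \<le> n}"
    by (intro finite_lists_length_le finite_cartesian_product) auto
  ultimately show ?thesis
    by (rule finite_subset)
qed

lemma has_sum_weighted_flags: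
  fixes s :: "'k::field \<Rightarrow> 'v::{ab_group_add, finite} \<Rightarrow> 'v"
  assumes "vector_space s"
  shows "((\<lambda>F. fps_X ^ flag_weight s F) has_sum weighted_flag_series s B) (weighted_flags s B)"
proof -
  have eq: "{F \<in> weighted_flags s B. fps_nth (fps_X ^ flag_weight s F :: int fps) n \<noteq> 0} =
          {F \<in> weighted_flags s B. flag_weight s F = n}" for n
    by (auto simp: fps_X_power_nth)
  have "((\<lambda>F. fps_X ^ flag_weight s F) has_sum
          Abs_fps (\<lambda>n. int (card {F \<in> weighted_flags s B. flag_weight s F = n})))
        (weighted_flags s B)"
  proof (rule has_sum_fpsI)
    show "finite {F \<in> weighted_flags s B. fps_nth (fps_X ^ flag_weight s F :: int fps) n \<noteq> 0}" for n
      unfolding eq by (rule finite_weighted_flags_weight[OF assms])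
    show "fps_nth (Abs_fps (\<lambda>n. int (card {F \<in> weighted_flags s B. flag_weight s F = n}))) n =
        (\<Sum>F | F \<in> weighted_flags s B \<and> fps_nth (fps_X ^ flag_weight s F :: int fps) n \<noteq> 0.
           fps_nth (fps_X ^ flag_weight s F) n)" for n
      unfolding eq by (simp add: fps_X_power_nth)
  qed
  then show ?thesis
    unfolding weighted_flag_series_def using has_sum_infsum summable_on_def by blast
qed

end

theory Submission
  imports Defs
begin

text \<open>
  In both spaces an isotropic subspace \<open>U\<close> of dimension \<open>k\<close> can be enlarged by equally many
  vectors: exactly \<open>q ^ (2 * d - k)\<close> vectors \<open>x\<close> have \<open>U + \<langle>x\<rangle>\<close> isotropic. In the symplectic space
  these are all vectors of \<open>U\<^sup>\<bottom>\<close>. In the quadratic space \<open>U\<close> lies in an isotropic \<open>N\<close> of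
  dimension \<open>d\<close>, namely \<open>U + (M \<inter> U\<^sup>\<bottom>)\<close> for any \<open>d\<close>-dimensional isotropic \<open>M\<close>; the
  zeros of \<open>Q\<close> make up a \<open>1/q\<close> fraction of \<open>U\<^sup>\<bottom> - N\<^sup>\<bottom>\<close>, because \<open>Q\<close> is affine and
  not constant on each coset of \<open>N\<close> there, and also of \<open>N\<^sup>\<bottom>\<close>, where they form \<open>N\<close> itself.
  Counting the pairs \<open>(x, V)\<close> with \<open>x \<in> V - U\<close> then shows that the number of isotropic \<open>V \<supseteq> U\<close> of
  given dimension depends only on \<open>dim U\<close>, and hence so does the number of weighted flags of given
  weight consisting of proper extensions of \<open>U\<close>.
\<close>

section \<open>Fibres of additive maps, and finite fields of odd order\<close>

lemma card_fibre_additive: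
  fixes f :: "'a::ab_group_add \<Rightarrow> 'b::ab_group_add"
  assumes add: "\<And>x y. f (x + y) = f x + f y"
    and A: "\<And>x y. x \<in> A \<Longrightarrow> y \<in> A \<Longrightarrow> x + y \<in> A"
      "\<And>x y. x \<in> A \<Longrightarrow> y \<in> A \<Longrightarrow> x - y \<in> A"
    and "a \<in> A"
  shows "card {x \<in> A. f x = f a} = card {x \<in> A. f x = 0}"
proof -
  have diff: "f (x - y) = f x - f y" for x y
    using add[of "x - y" y] by simp
  have "bij_betw (\<lambda>x. x - a) {x \<in> A. f x = f a} {x \<in> A. f x = 0}"
    by (rule bij_betw_byWitness[where f' = "\<lambda>x. x + a"]) (use assms diff in auto)
  then show ?thesis by (rule bij_betw_same_card)
qed

text \<open>All nonempty fibres are translates of the kernel, so this is the first isomorphism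
  theorem in cardinalities. Working with a set \<open>A\<close> closed under sums and differences
  makes it applicable to subspaces and to products of subspaces.\<close>

lemma card_image_times_card_kernel:
  fixes f :: "'a::ab_group_add \<Rightarrow> 'b::ab_group_add"
  assumes "\<And>x y. f (x + y) = f x + f y"
    and "\<And>x y. x \<in> A \<Longrightarrow> y \<in> A \<Longrightarrow> x + y \<in> A"
    and "\<And>x y. x \<in> A \<Longrightarrow> y \<in> A \<Longrightarrow> x - y \<in> A"
    and "finite A"
  shows "card (f ` A) * card {x \<in> A. f x = 0} = card A"
proof -
  have "card A = (\<Sum>y\<in>f ` A. card {x \<in> A. f x = y})"
    using sum.image_gen[OF \<open>finite A\<close>, of "\<lambda>_. 1::nat" f] by simp
  also have "\<dots> = (\<Sum>y\<in>f ` A. card {x \<in> A. f x = 0})"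
    by (rule sum.cong) (use card_fibre_additive[of f A, OF assms(1-3)] in auto)
  finally show ?thesis by simp
qed

text \<open>If 2 were 0, then \<open>x - x\<^sup>2\<close> would be additive with kernel
  \<open>{0, 1}\<close>, so 2 would divide the order of the field.\<close>

lemma two_neq_zero_if_odd_card:
  assumes "odd (CARD('k::{field, finite}))"
  shows "(2 :: 'k) \<noteq> 0"
proof
  assume two: "(2 :: 'k) = 0"
  let ?f = "\<lambda>x::'k. x - x\<^sup>2"
  have add: "?f (x + y) = ?f x + ?f y" for x y
    using two by (simp add: power2_sum)
  have "card (range ?f) * card {x \<in> UNIV. ?f x = 0} = CARD('k)"
    by (rule card_image_times_card_kernel) (use add in auto)
  moreover have "{x \<in> UNIV. ?f x = 0} = {0, 1}"
    by (auto simp: power2_eq_square)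
  ultimately have "card (range ?f) * 2 = CARD('k)" by simp
  with assms show False by (metis even_mult_iff even_numeral)
qed

lemma card_field_gt_1: "CARD('k::{field, finite}) > 1"
  using card_mono[of UNIV "{0, 1 :: 'k}"] by simp

section \<open>Orthogonality for a reflexive form on a finite space\<close>

text \<open>Alternating and symmetric forms both satisfy \<open>reflexive\<close>, so this is the
  common setting for the symplectic and the quadratic space.\<close>

locale finite_reflexive_space = vector_space s
  for s :: "'k::{field, finite} \<Rightarrow> 'v::{ab_group_add, finite} \<Rightarrow> 'v" +
  fixes B :: "'v \<Rightarrow> 'v \<Rightarrow> 'k"
  assumes bilinear: "bilinear_form s B"
    and reflexive: "B x y = 0 \<Longrightarrow> B y x = 0"
begin

lemma form_add_left: "B (x + y) z = B x z + B y z"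
  and form_add_right: "B z (x + y) = B z x + B z y"
  and form_scale_left: "B (s c x) z = c * B x z"
  and form_scale_right: "B z (s c x) = c * B z x"
proof -
  have "Vector_Spaces.linear s (*) (\<lambda>x. B x z)" "Vector_Spaces.linear s (*) (B z)"
    using bilinear by (simp_all add: bilinear_form_def)
  then show "B (x + y) z = B x z + B y z" "B z (x + y) = B z x + B z y"
    "B (s c x) z = c * B x z" "B z (s c x) = c * B z x"
    unfolding Vector_Spaces.linear_iff by blast+
qed

lemma form_zero_left [simp]: "B 0 z = 0"
  and form_zero_right [simp]: "B z 0 = 0"
  using form_scale_left[of 0 0 z] form_scale_right[of z 0 0] by simp_all

definition orth :: "'v set \<Rightarrow> 'v set" where
  "orth S = {x. \<forall>y\<in>S. B y x = 0}"

lemma subspace_orth: "subspace (orth S)"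
  by (rule subspaceI) (auto simp: orth_def form_add_right form_scale_right)

lemma orth_mono: "S \<subseteq> T \<Longrightarrow> orth T \<subseteq> orth S"
  by (auto simp: orth_def)

lemma isotropic_iff: "isotropic s B U \<longleftrightarrow> subspace U \<and> U \<subseteq> orth U"
  by (auto simp: isotropic_def orth_def)

lemma isotropic_zero: "isotropic s B {0}"
  by (auto simp: isotropic_iff orth_def subspace_def)

lemma isotropic_subspace: "isotropic s B V \<Longrightarrow> subspace U \<Longrightarrow> U \<subseteq> V \<Longrightarrow> isotropic s B U"
  by (auto simp: isotropic_def)

text \<open>The multiples of \<open>a\<close> already attain every value of the field. Hence the
  functional has \<open>CARD('k)\<close> nonempty fibres on \<open>U\<close>, all translates of its
  kernel.\<close>

lemma card_kernel_functional:
  assumes "subspace U" "a \<in> U" "B x a \<noteq> 0"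
  shows "CARD('k) * card {u \<in> U. B x u = c} = card U"
proof -
  have *: "s (c' / B x a) a \<in> U" "B x (s (c' / B x a) a) = c'" for c'
    using assms subspace_scale by (auto simp: form_scale_right)
  have closed: "u + v \<in> U" "u - v \<in> U" if "u \<in> U" "v \<in> U" for u v
    using assms(1) that by (auto intro: subspace_add subspace_diff)
  have "B x ` U = UNIV"
    using * by (metis UNIV_eq_I image_eqI)
  moreover have "card (B x ` U) * card {u \<in> U. B x u = 0} = card U"
    by (rule card_image_times_card_kernel) (auto simp: form_add_right closed)
  moreover have "card {u \<in> U. B x u = c} = card {u \<in> U. B x u = 0}"
    using card_fibre_additive[of "B x" U, OF form_add_right closed *(1)[of c]] *(2)[of c] by simp
  ultimately show ?thesis by simp
qed

text \<open>
  Count the pairs \<open>(x, y) \<in> X \<times> Y\<close> with \<open>B x y = 0\<close> in two ways: a functional on \<open>Y\<close> vanishes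
  either on all of \<open>Y\<close> or on a \<open>1/q\<close> fraction of it.
\<close>

lemma card_inter_orth:
  assumes "subspace X" "subspace Y"
  shows "card (X \<inter> orth Y) * card Y = card X * card (Y \<inter> orth X)"
proof -
  let ?q = "CARD('k)"
  have count: "?q * (\<Sum>x\<in>X. card {y \<in> Y. B x y = 0}) =
      ?q * card (X \<inter> orth Y) * card Y + (card X - card (X \<inter> orth Y)) * card Y"
    if "subspace X" "subspace Y" for X Y
  proof -
    have "?q * (\<Sum>x\<in>X. card {y \<in> Y. B x y = 0}) = (\<Sum>x\<in>X. ?q * card {y \<in> Y. B x y = 0})"
      by (simp add: sum_distrib_left)
    also have "\<dots> = (\<Sum>x\<in>X. if x \<in> orth Y then ?q * card Y else card Y)"
    proof (rule sum.cong)
      fix x assume "x \<in> X"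
      show "?q * card {y \<in> Y. B x y = 0} = (if x \<in> orth Y then ?q * card Y else card Y)"
      proof (cases "x \<in> orth Y")
        case True
        then have "{y \<in> Y. B x y = 0} = Y"
          by (auto simp: orth_def intro: reflexive)
        then show ?thesis using True by simp
      next
        case False
        then obtain a where "a \<in> Y" "B x a \<noteq> 0"
          by (auto simp: orth_def dest: reflexive)
        then show ?thesis using False card_kernel_functional[OF \<open>subspace Y\<close>] by simp
      qed
    qed simp
    also have "\<dots> = ?q * card (X \<inter> orth Y) * card Y + card (X - orth Y) * card Y"
      by (simp add: sum.If_cases Diff_eq)
    also have "card (X - orth Y) = card X - card (X \<inter> orth Y)"
      by (simp add: card_Diff_subset_Int)
    finally show ?thesis .
  qed
  have "(\<Sum>x\<in>X. card {y \<in> Y. B x y = 0}) = (\<Sum>y\<in>Y. card {x \<in> X. B x y = 0})"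
    using sum.swap_restrict[of X Y "\<lambda>_ _. 1::nat" "\<lambda>x y. B x y = 0"] by simp
  also have "\<dots> = (\<Sum>y\<in>Y. card {x \<in> X. B y x = 0})"
    by (intro sum.cong refl arg_cong[where f = card]) (auto intro: reflexive)
  finally have sym: "(\<Sum>x\<in>X. card {y \<in> Y. B x y = 0}) = (\<Sum>y\<in>Y. card {x \<in> X. B y x = 0})" .
  define a b where "a = card (X \<inter> orth Y)" and "b = card (Y \<inter> orth X)"
  have le: "a \<le> card X" "b \<le> card Y"
    by (auto simp: a_def b_def intro: card_mono)
  have "?q * a * card Y + (card X - a) * card Y = ?q * b * card X + (card Y - b) * card X"
    using count[OF assms] count[OF assms(2,1)] sym by (simp add: a_def b_def)
  \<comment> \<open>Over the integers each side becomes \<open>card X * card Y\<close> plus a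
    multiple of \<open>?q - 1\<close>; the common summand cancels.\<close>
  then have "int ?q * a * card Y + (int (card X) - a) * card Y =
      int ?q * b * card X + (int (card Y) - b) * card X"
    using le by (metis (no_types, opaque_lifting) of_nat_add of_nat_diff of_nat_mult)
  then have "(int ?q - 1) * (int a * card Y) = (int ?q - 1) * (int b * card X)"
    by (simp add: algebra_simps)
  moreover have "?q > 1" by (rule card_field_gt_1)
  ultimately have "int a * card Y = int b * card X" by simp
  then have "int (a * card Y) = int (card X * b)" by (simp add: mult.commute)
  then have "a * card Y = card X * b" using of_nat_eq_iff by blast
  then show ?thesis by (simp add: a_def b_def)
qed

text \<open>This is the case of \<open>card_inter_orth\<close> where one subspace is the whole
  space, whose orthogonal complement is \<open>{0}\<close> by non-degeneracy.\<close>

lemma card_orth: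
  assumes "nondegenerate B" "subspace U"
  shows "card (orth U) * card U = CARD('v)"
proof -
  have "orth UNIV = {0}"
    using assms(1) by (auto simp: orth_def nondegenerate_def intro: reflexive)
  moreover have "0 \<in> U" using assms(2) by (rule subspace_0)
  ultimately have "U \<inter> orth UNIV = {0}" by auto
  with card_inter_orth[OF subspace_UNIV assms(2)] show ?thesis by simp
qed

section \<open>Cardinalities of sums and spans, and their relation to dimension\<close>

text \<open>The addition map on \<open>X \<times> Y\<close> has as kernel the pairs
  \<open>(x, - x)\<close> with \<open>x \<in> X \<inter> Y\<close>.\<close>

lemma card_sum_subspace:
  assumes "subspace X" "subspace Y"
  shows "card {x + y |x y. x \<in> X \<and> y \<in> Y} * card (X \<inter> Y) = card X * card Y"
proof -
  let ?f = "\<lambda>(x, y). x + y"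
  have "card (?f ` (X \<times> Y)) * card {p \<in> X \<times> Y. ?f p = 0} = card (X \<times> Y)"
    by (rule card_image_times_card_kernel)
       (use assms in \<open>auto intro: subspace_add subspace_diff\<close>)
  moreover have "?f ` (X \<times> Y) = {x + y |x y. x \<in> X \<and> y \<in> Y}" by force
  moreover have "card {p \<in> X \<times> Y. ?f p = 0} = card (X \<inter> Y)"
  proof -
    have "{p \<in> X \<times> Y. ?f p = 0} = (\<lambda>x. (x, - x)) ` (X \<inter> Y)"
    proof (intro equalityI subsetI)
      fix p assume "p \<in> {p \<in> X \<times> Y. ?f p = 0}"
      then obtain x y where p: "p = (x, y)" "x \<in> X" "y \<in> Y" "x + y = 0" by auto
      then have "y = - x" by (simp add: add_eq_0_iff)
      moreover from this have "x \<in> Y" using subspace_neg[OF assms(2) p(3)] by simp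
      ultimately show "p \<in> (\<lambda>x. (x, - x)) ` (X \<inter> Y)" using p by blast
    qed (use subspace_neg[OF assms(2)] in auto)
    moreover have "inj_on (\<lambda>x. (x, - x)) (X \<inter> Y)" by (rule inj_onI) simp
    ultimately show ?thesis by (simp only: card_image)
  qed
  ultimately show ?thesis by (simp only: card_cartesian_product)
qed

text \<open>The map \<open>(c, y) \<mapsto> s c a + y\<close> is a bijection from pairs of a scalar
  and a vector of \<open>span S\<close>; injectivity holds because no nonzero multiple of
  \<open>a\<close> lies in \<open>span S\<close>.\<close>

lemma card_span_insert:
  assumes "a \<notin> span S"
  shows "card (span (insert a S)) = CARD('k) * card (span S)"
proof -
  have "inj_on (\<lambda>(c, y). s c a + y) (UNIV \<times> span S)"
  proof (rule inj_onI, clarify)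
    fix c y c' y'
    assume y: "y \<in> span S" "y' \<in> span S" and eq: "s c a + y = s c' a + y'"
    have "s (c - c') a = y' - y"
      using eq by (simp add: scale_left_diff_distrib algebra_simps)
    then have "s (c - c') a \<in> span S" using y by (simp add: span_diff)
    then have "c = c'"
      using assms span_scale[of "s (c - c') a" S "inverse (c - c')"] by (cases "c = c'") auto
    with eq show "c = c' \<and> y = y'" by simp
  qed
  moreover have "(\<lambda>(c, y). s c a + y) ` (UNIV \<times> span S) = span (insert a S)"
  proof (intro equalityI subsetI)
    fix x assume "x \<in> span (insert a S)"
    then obtain k where "x - s k a \<in> span S" by (auto simp: span_insert)
    then show "x \<in> (\<lambda>(c, y). s c a + y) ` (UNIV \<times> span S)"
      by (intro image_eqI[of _ _ "(k, x - s k a)"]) auto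
  next
    fix x assume "x \<in> (\<lambda>(c, y). s c a + y) ` (UNIV \<times> span S)"
    then obtain c y where "x = s c a + y" "y \<in> span S" by auto
    then have "x - s c a \<in> span S" by simp
    then show "x \<in> span (insert a S)" by (auto simp: span_insert)
  qed
  ultimately show ?thesis
    by (metis card_image card_cartesian_product)
qed

lemma card_subspace:
  assumes "subspace U"
  shows "card U = CARD('k) ^ dim U"
proof -
  have indep: "card (span S) = CARD('k) ^ card S" if "independent S" for S
    using finite[of S] that
  proof (induction S rule: finite_induct)
    case (insert a S)
    then have "a \<notin> span S" "independent S"
      by (auto simp: independent_insert)
    then show ?case using insert by (simp add: card_span_insert)
  qed simp
  obtain A where A: "A \<subseteq> U" "independent A" "U \<subseteq> span A" "card A = dim U"
    using basis_exists by blast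
  have "span A = U"
    using A assms span_minimal by blast
  with indep[OF A(2)] A(4) show ?thesis by simp
qed

lemma dim_eq_iff_card_eq:
  assumes "subspace U"
  shows "dim U = k \<longleftrightarrow> card U = CARD('k) ^ k"
  using card_subspace[OF assms] card_field_gt_1[where 'k = 'k] by simp

lemma dim_span_insert:
  assumes "subspace U" "x \<notin> U"
  shows "dim (span (insert x U)) = Suc (dim U)"
proof -
  have "span U = U" using assms(1) by (simp add: span_eq_iff)
  with card_span_insert[of x U] assms have "card (span (insert x U)) = CARD('k) * card U" by simp
  then have "card (span (insert x U)) = CARD('k) ^ Suc (dim U)"
    using assms(1) by (simp add: card_subspace)
  then show ?thesis
    using dim_eq_iff_card_eq subspace_span by blast
qed

section \<open>Vectors that enlarge an isotropic subspace to an isotropic one\<close>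

text \<open>For the converse, expand \<open>B (s k x + u) (s l x + v)\<close>: the four terms
  contain \<open>B x x\<close>, \<open>B x v\<close>, \<open>B u x\<close> and \<open>B u v\<close>,
  which all vanish.\<close>

lemma isotropic_span_insert_iff:
  assumes "isotropic s B U"
  shows "isotropic s B (span (insert x U)) \<longleftrightarrow> x \<in> orth U \<and> B x x = 0"
proof
  assume "isotropic s B (span (insert x U))"
  moreover have "x \<in> span (insert x U)" "U \<subseteq> span (insert x U)"
    by (auto intro: span_base)
  ultimately show "x \<in> orth U \<and> B x x = 0"
    by (auto simp: isotropic_def orth_def)
next
  assume x: "x \<in> orth U \<and> B x x = 0"
  have "span U = U" using assms by (simp add: isotropic_def span_eq_iff)
  have "B y z = 0" if y: "y \<in> span (insert x U)" and z: "z \<in> span (insert x U)" for y z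
  proof -
    obtain k u where "y = s k x + u" "u \<in> U"
      using y \<open>span U = U\<close> by (auto simp: span_insert) (metis add.commute diff_add_cancel)
    moreover obtain l v where "z = s l x + v" "v \<in> U"
      using z \<open>span U = U\<close> by (auto simp: span_insert) (metis add.commute diff_add_cancel)
    moreover have "B u v = 0" using assms calculation by (auto simp: isotropic_def)
    moreover have "B u x = 0" "B v x = 0" using x calculation by (auto simp: orth_def)
    ultimately show ?thesis
      using x reflexive
      by (simp add: form_add_left form_add_right form_scale_left form_scale_right)
  qed
  then show "isotropic s B (span (insert x U))"
    by (simp add: isotropic_def)
qed

text \<open>From \<open>U \<subseteq> orth U\<close> and \<open>card_orth\<close>: an isotropic
  subspace has at most half the dimension of the space.\<close>

lemma card_isotropic_le:
  assumes "nondegenerate B" "isotropic s B U"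
  shows "card U * card U \<le> CARD('v)"
proof -
  have "card U \<le> card (orth U)"
    using assms(2) by (intro card_mono) (auto simp: isotropic_iff)
  then show ?thesis
    using card_orth[OF assms(1)] assms(2) by (metis isotropic_iff mult_le_mono1)
qed

text \<open>Every vector of \<open>orth U\<close> qualifies, since \<open>B x x = 0\<close> always
  holds. The vectors of \<open>U\<close> itself are counted too.\<close>

lemma card_isotropic_vectors_alternating:
  assumes "nondegenerate B" "\<And>x. B x x = 0" "isotropic s B U"
  shows "card {x. isotropic s B (span (insert x U))} * card U = CARD('v)"
proof -
  have "subspace U" using assms(3) by (simp add: isotropic_def)
  with card_orth[OF assms(1)] assms show ?thesis by (simp add: isotropic_span_insert_iff)
qed

text \<open>Take \<open>N = U + P\<close> with \<open>P = M \<inter> orth U\<close>: two isotropic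
  subspaces orthogonal to each other. By \<open>card_inter_orth\<close>,
  \<open>card U * card P = card M * card (U \<inter> orth M)\<close>, and the last factor equals
  \<open>card (U \<inter> P)\<close> by the third assumption, so
  \<open>card N = card M\<close>.\<close>

lemma isotropic_le_maximal:
  assumes "isotropic s B M" "isotropic s B U" "U \<inter> orth M = U \<inter> M"
  obtains N where "isotropic s B N" "U \<subseteq> N" "card N = card M"
proof
  define P where "P = M \<inter> orth U"
  define N where "N = {u + p |u p. u \<in> U \<and> p \<in> P}"
  have sub: "subspace U" "subspace M" "subspace P"
    using assms by (auto simp: isotropic_iff P_def subspace_orth intro: subspace_inter)
  have "card N * card (U \<inter> P) = card U * card P"
    unfolding N_def by (rule card_sum_subspace[OF sub(1,3)])
  moreover have "card P * card U = card M * card (U \<inter> M)"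
    using card_inter_orth[OF sub(2,1)] assms(3) by (simp add: P_def)
  moreover have "U \<inter> P = U \<inter> M"
    using assms(2) by (auto simp: P_def isotropic_iff)
  moreover have "U \<inter> M \<noteq> {}"
    using subspace_0[OF sub(1)] subspace_0[OF sub(2)] by auto
  ultimately show "card N = card M" by (simp add: mult.commute)
  have "u + 0 \<in> N" if "u \<in> U" for u
    unfolding N_def using that subspace_0[OF sub(3)] by blast
  then show "U \<subseteq> N" by auto
  have "subspace N"
    unfolding N_def by (rule subspace_sums[OF sub(1,3)])
  moreover have "B (u + p) (v + p') = 0" if "u \<in> U" "v \<in> U" "p \<in> P" "p' \<in> P" for u v p p'
    using that assms(1,2) reflexive[of v p]
    by (auto simp: form_add_left form_add_right isotropic_def P_def orth_def)
  ultimately show "isotropic s B N"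
    unfolding isotropic_def N_def by blast
qed

text \<open>
  On a coset \<open>x + N\<close> the form \<open>B y y\<close> is affine, with linear part \<open>2 * B x _\<close>; if this is not
  identically zero, then exactly a \<open>1/q\<close> fraction of the coset is isotropic.
\<close>

lemma card_isotropic_vectors_outside_orth:
  assumes "\<And>x y. B x y = B y x" "(2 :: 'k) \<noteq> 0" "isotropic s B N" "N \<subseteq> T" "subspace T"
  shows "CARD('k) * card {x \<in> T - orth N. B x x = 0} = card (T - orth N)"
proof -
  define X where "X = T - orth N"
  have subN: "subspace N" using assms(3) by (simp add: isotropic_iff)
  have expand: "B (x + n) (x + n) = B x x + 2 * B x n" if "n \<in> N" for x n
    using that assms(1,3) by (auto simp: isotropic_def form_add_left form_add_right)
  have shift: "x + n \<in> X \<and> x - n \<in> X" if "x \<in> X" "n \<in> N" for x n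
  proof -
    have "n \<in> T" "n \<in> orth N" using that assms(3,4) by (auto simp: isotropic_iff)
    moreover have "x \<in> orth N" if "x + n \<in> orth N \<or> x - n \<in> orth N"
      using that subspace_add[OF subspace_orth \<open>n \<in> orth N\<close>, of "x - n"]
        subspace_diff[OF subspace_orth _ \<open>n \<in> orth N\<close>, of "x + n"] by auto
    ultimately show ?thesis
      using that(1) \<open>x \<in> X\<close> assms(5) by (auto simp: X_def intro: subspace_add subspace_diff)
  qed
  \<comment> \<open>Count the pairs \<open>(x, n)\<close> with \<open>B (x + n) (x + n) = 0\<close>
    in two ways. For fixed \<open>x\<close> they form a \<open>1/q\<close> fraction of
    \<open>N\<close>; for fixed \<open>n\<close>, translation by \<open>n\<close> permutes
    \<open>X\<close>.\<close>
  have "CARD('k) * (\<Sum>x\<in>X. card {n \<in> N. B (x + n) (x + n) = 0}) =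
      (\<Sum>x\<in>X. CARD('k) * card {n \<in> N. B x n = - B x x / 2})"
    unfolding sum_distrib_left
  proof (intro sum.cong refl arg_cong2[where f = "(*)"] arg_cong[where f = card] Collect_cong
      conj_cong)
    fix x n assume "n \<in> N"
    then show "B (x + n) (x + n) = 0 \<longleftrightarrow> B x n = - B x x / 2"
      unfolding expand[OF \<open>n \<in> N\<close>] using assms(2) by (simp add: field_simps add_eq_0_iff)
  qed
  also have "\<dots> = (\<Sum>x\<in>X. card N)"
  proof (rule sum.cong)
    fix x assume "x \<in> X"
    then obtain a where "a \<in> N" "B x a \<noteq> 0"
      using assms(1) by (auto simp: X_def orth_def)
    then show "CARD('k) * card {n \<in> N. B x n = - B x x / 2} = card N"
      by (rule card_kernel_functional[OF subN])
  qed simp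
  finally have "CARD('k) * (\<Sum>x\<in>X. card {n \<in> N. B (x + n) (x + n) = 0}) = card X * card N"
    by simp
  also have "(\<Sum>x\<in>X. card {n \<in> N. B (x + n) (x + n) = 0}) =
      (\<Sum>n\<in>N. card {x \<in> X. B (x + n) (x + n) = 0})"
    using sum.swap_restrict[of X N "\<lambda>_ _. 1::nat" "\<lambda>x n. B (x + n) (x + n) = 0"] by simp
  also have "\<dots> = (\<Sum>n\<in>N. card {x \<in> X. B x x = 0})"
  proof (rule sum.cong)
    fix n assume "n \<in> N"
    then have "bij_betw (\<lambda>x. x + n) {x \<in> X. B (x + n) (x + n) = 0} {x \<in> X. B x x = 0}"
      by (intro bij_betw_byWitness[where f' = "\<lambda>x. x - n"]) (auto simp: shift)
    then show "card {x \<in> X. B (x + n) (x + n) = 0} = card {x \<in> X. B x x = 0}"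
      by (rule bij_betw_same_card)
  qed simp
  finally have "CARD('k) * card {x \<in> X. B x x = 0} * card N = card X * card N"
    by (simp add: mult.commute mult.left_commute)
  moreover have "card N > 0"
    using subspace_0[OF subN] by (auto simp: card_gt_0_iff)
  ultimately show ?thesis by (auto simp: X_def)
qed

text \<open>Otherwise \<open>span (insert x N)\<close> would be isotropic with
  \<open>CARD('k) * card N\<close> elements, exceeding the bound
  \<open>card_isotropic_le\<close>.\<close>

lemma isotropic_vector_orth_maximal:
  assumes "nondegenerate B" "isotropic s B N" "CARD('v) < (CARD('k) * card N)\<^sup>2"
    and "x \<in> orth N" "B x x = 0"
  shows "x \<in> N"
proof (rule ccontr)
  assume "x \<notin> N"
  moreover have "span N = N" using assms(2) by (simp add: isotropic_iff span_eq_iff)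
  ultimately have "card (span (insert x N)) = CARD('k) * card N"
    using card_span_insert[of x N] by metis
  moreover have "isotropic s B (span (insert x N))"
    using assms by (simp add: isotropic_span_insert_iff)
  ultimately show False
    using card_isotropic_le[OF assms(1)] assms(3) by (fastforce simp: power2_eq_square)
qed

text \<open>The condition on \<open>card M\<close> expresses that the whole space has dimension
  \<open>2 * dim M + 1\<close>, so \<open>M\<close> has the largest dimension possible.\<close>

lemma card_isotropic_vectors_symmetric:
  assumes "nondegenerate B" "\<And>x y. B x y = B y x" "(2 :: 'k) \<noteq> 0"
    and M: "isotropic s B M" "CARD('v) = CARD('k) * (card M)\<^sup>2"
    and U: "isotropic s B U"
  shows "CARD('k) * (card {x. isotropic s B (span (insert x U))} * card U) = CARD('v)"
proof -
  have pos: "card N > 0" if "isotropic s B N" for N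
    using that subspace_0[of N] by (auto simp: card_gt_0_iff isotropic_iff)
  have less: "CARD('v) < (CARD('k) * card N)\<^sup>2" if "card N = card M" for N
    using that M(2) pos[OF M(1)] card_field_gt_1[where 'k = 'k]
    by (simp add: power_mult_distrib power2_eq_square)
  have "U \<inter> orth M = U \<inter> M"
    using isotropic_vector_orth_maximal[OF assms(1) M(1) less] U M(1)
    by (auto simp: isotropic_def orth_def)
  then obtain N where N: "isotropic s B N" "U \<subseteq> N" "card N = card M"
    using isotropic_le_maximal[OF M(1) U] by blast
  have "N \<subseteq> orth N" using N(1) by (simp add: isotropic_iff)
  have "orth N \<subseteq> orth U" using N(2) by (rule orth_mono)
  have "{x \<in> orth N. B x x = 0} = N"
    using isotropic_vector_orth_maximal[OF assms(1) N(1) less[OF N(3)]] N(1)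
    by (auto simp: isotropic_def orth_def)
  moreover have "card (orth N) = CARD('k) * card N"
  proof -
    have "card (orth N) * card N = CARD('k) * card N * card N"
      using card_orth[OF assms(1), of N] N M(2) by (auto simp: isotropic_iff power2_eq_square)
    then show ?thesis using pos[OF N(1)] by auto
  qed
  \<comment> \<open>The ratio 1 to q thus holds on both pieces of \<open>orth U\<close>: on
    \<open>orth N\<close> it is \<open>card N\<close> against
    \<open>CARD('k) * card N\<close>.\<close>
  moreover have "CARD('k) * card {x \<in> orth U - orth N. B x x = 0} = card (orth U - orth N)"
    by (rule card_isotropic_vectors_outside_orth)
       (use assms N \<open>N \<subseteq> orth N\<close> \<open>orth N \<subseteq> orth U\<close> subspace_orth in auto)
  moreover have "card {x \<in> orth U. B x x = 0} =
      card {x \<in> orth N. B x x = 0} + card {x \<in> orth U - orth N. B x x = 0}"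
  proof -
    have "{x \<in> orth U. B x x = 0} =
        {x \<in> orth N. B x x = 0} \<union> {x \<in> orth U - orth N. B x x = 0}"
      using \<open>orth N \<subseteq> orth U\<close> by auto
    then show ?thesis by (simp only:) (rule card_Un_disjoint, auto)
  qed
  moreover have "card (orth U) = card (orth N) + card (orth U - orth N)"
    using \<open>orth N \<subseteq> orth U\<close> by (simp add: card_Diff_subset card_mono)
  ultimately have "CARD('k) * card {x \<in> orth U. B x x = 0} = card (orth U)"
    by (simp add: algebra_simps)
  then have "CARD('k) * card {x. isotropic s B (span (insert x U))} = card (orth U)"
    using U by (simp add: isotropic_span_insert_iff)
  then show ?thesis
    using card_orth[OF assms(1), of U] U by (simp add: isotropic_iff mult.assoc[symmetric])
qed

section \<open>Isotropic extensions of given dimension\<close>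

definition extensions :: "'v set \<Rightarrow> nat \<Rightarrow> 'v set set" where
  "extensions U m = {V. isotropic s B V \<and> U \<subseteq> V \<and> dim V = m}"

lemma extensions_dim:
  assumes "isotropic s B U"
  shows "extensions U (dim U) = {U}"
proof -
  have "V = U" if "isotropic s B V" "U \<subseteq> V" "dim V = dim U" for V
    using that assms card_subspace[of U] card_subspace[of V]
    by (metis card_subset_eq finite isotropic_iff)
  then show ?thesis using assms by (auto simp: extensions_def)
qed

lemma extensions_empty:
  assumes "isotropic s B U" "m < dim U"
  shows "extensions U m = {}"
proof -
  have False if "isotropic s B V" "U \<subseteq> V" "dim V = m" for V
  proof -
    have "card U \<le> card V" using that by (intro card_mono) auto
    then have "dim U \<le> dim V"
      using that assms card_subspace[of U] card_subspace[of V] card_field_gt_1[where 'k = 'k]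
      by (simp add: isotropic_iff)
    with that assms show False by simp
  qed
  then show ?thesis by (auto simp: extensions_def)
qed

text \<open>
  Both sides count the pairs \<open>(x, V)\<close> with \<open>V\<close> an isotropic extension of \<open>U\<close> of dimension \<open>m\<close>
  and \<open>x \<in> V - U\<close>.
\<close>

lemma card_extensions_rec:
  assumes "isotropic s B U"
  shows "card (extensions U m) * (CARD('k) ^ m - CARD('k) ^ dim U) =
    (\<Sum>x\<in>{x. isotropic s B (span (insert x U))} - U. card (extensions (span (insert x U)) m))"
proof -
  have "card (extensions U m) * (CARD('k) ^ m - CARD('k) ^ dim U) =
      (\<Sum>V\<in>extensions U m. card {x \<in> UNIV. x \<in> V - U})"
  proof -
    have "card {x \<in> UNIV. x \<in> V - U} = CARD('k) ^ m - CARD('k) ^ dim U"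
      if "V \<in> extensions U m" for V
    proof -
      have "isotropic s B V" "U \<subseteq> V" "dim V = m" using that by (auto simp: extensions_def)
      moreover have "{x \<in> UNIV. x \<in> V - U} = V - U" by auto
      ultimately show ?thesis
        using card_subspace[of V] card_subspace[of U] assms
        by (simp add: isotropic_iff card_Diff_subset)
    qed
    then show ?thesis by simp
  qed
  also have "\<dots> = (\<Sum>x\<in>UNIV. card {V \<in> extensions U m. x \<in> V - U})"
    using sum.swap_restrict[of "extensions U m" UNIV "\<lambda>_ _. 1::nat" "\<lambda>V x. x \<in> V - U"] by simp
  also have "\<dots> = (\<Sum>x\<in>{x. isotropic s B (span (insert x U))} - U.
      card {V \<in> extensions U m. x \<in> V - U})"
  \<comment> \<open>If \<open>x \<in> V - U\<close> for an isotropic \<open>V \<supseteq> U\<close>,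
    then \<open>span (insert x U)\<close> lies in \<open>V\<close> and is isotropic; all other
    vectors contribute 0.\<close>
  proof (rule sum.mono_neutral_right)
    show "\<forall>x\<in>UNIV - ({x. isotropic s B (span (insert x U))} - U).
        card {V \<in> extensions U m. x \<in> V - U} = 0"
    proof
      fix x assume x: "x \<in> UNIV - ({x. isotropic s B (span (insert x U))} - U)"
      have "{V \<in> extensions U m. x \<in> V - U} = {}"
      proof (rule ccontr)
        assume "{V \<in> extensions U m. x \<in> V - U} \<noteq> {}"
        then obtain V where V: "isotropic s B V" "U \<subseteq> V" "x \<in> V" "x \<notin> U"
          by (auto simp: extensions_def)
        then have "span (insert x U) \<subseteq> V"
          by (intro span_minimal) (auto simp: isotropic_iff)
        with V(1) have "isotropic s B (span (insert x U))"
          using isotropic_subspace subspace_span by blast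
        with x V show False by simp
      qed
      then show "card {V \<in> extensions U m. x \<in> V - U} = 0" by (simp only: card.empty)
    qed
  qed auto
  also have "\<dots> = (\<Sum>x\<in>{x. isotropic s B (span (insert x U))} - U.
      card (extensions (span (insert x U)) m))"
  proof (rule sum.cong, simp)
    fix x assume x: "x \<in> {x. isotropic s B (span (insert x U))} - U"
    have "span (insert x U) \<subseteq> V \<longleftrightarrow> x \<in> V \<and> U \<subseteq> V" if "isotropic s B V" for V
      using that span_minimal[of "insert x U" V] span_superset[of "insert x U"]
      unfolding isotropic_iff by blast
    then have "{V \<in> extensions U m. x \<in> V - U} = extensions (span (insert x U)) m"
      using x by (auto simp: extensions_def)
    then show "card {V \<in> extensions U m. x \<in> V - U} = card (extensions (span (insert x U)) m)"
      by simp
  qed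
  finally show ?thesis .
qed

section \<open>Weighted flags above a subspace\<close>

text \<open>For nonzero isotropic \<open>U\<close> these are the possible continuations of a flag
  whose last step is \<open>U\<close>; for \<open>U = {0}\<close> they are all flags of weight
  \<open>n\<close>.\<close>

definition flags_above :: "'v set \<Rightarrow> nat \<Rightarrow> ('v set \<times> nat) list set" where
  "flags_above U n = {F \<in> weighted_flags s B. (\<forall>(V, w)\<in>set F. U \<subset> V) \<and> flag_weight s F = n}"

lemma flags_above_zero: "flags_above {0} n = {F \<in> weighted_flags s B. flag_weight s F = n}"
proof -
  have "{0} \<subset> V" if "isotropic s B V" "V \<noteq> {0}" for V
    using that subspace_0[of V] by (auto simp: isotropic_def)
  then have "\<forall>(V, w)\<in>set F. {0} \<subset> V" if "F \<in> weighted_flags s B" for F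
    using that by (simp add: weighted_flags_def case_prod_unfold)
  then show ?thesis
    unfolding flags_above_def by blast
qed

lemma finite_flags_above: "finite (flags_above U n)"
  by (rule finite_subset[OF _ finite_weighted_flags_weight[OF vector_space_axioms, of B n]])
     (auto simp: flags_above_def)

text \<open>The condition \<open>w * dim V \<le> n\<close> guards against truncation in
  \<open>n - w * dim V\<close>.\<close>

lemma Cons_mem_flags_above_iff:
  "(V, w) # F \<in> flags_above U n \<longleftrightarrow>
     isotropic s B V \<and> V \<noteq> {0} \<and> U \<subset> V \<and> w > 0 \<and> w * dim V \<le> n \<and>
     F \<in> flags_above V (n - w * dim V)"
proof -
  have "flag_weight s ((V, w) # F) = n \<longleftrightarrow> w * dim V \<le> n \<and> flag_weight s F = n - w * dim V"
    by (auto simp: flag_weight_def)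
  moreover have "sorted_wrt (\<subset>) (map fst ((V, w) # F)) \<longleftrightarrow>
      (\<forall>(X, w)\<in>set F. V \<subset> X) \<and> sorted_wrt (\<subset>) (map fst F)"
    by (simp add: case_prod_unfold)
  moreover have "U \<subset> V \<longrightarrow> (\<forall>(X, w)\<in>set F. V \<subset> X) \<longrightarrow> (\<forall>(X, w)\<in>set F. U \<subset> X)"
    unfolding case_prod_unfold by (meson psubset_trans)
  ultimately show ?thesis
    unfolding flags_above_def weighted_flags_def mem_Collect_eq list.set ball_simps(7) prod.case
    by argo
qed

text \<open>Split off the first step \<open>V\<close>, of dimension \<open>m\<close> and weight
  \<open>w\<close>; the empty flag occurs only for \<open>n = 0\<close>. Since \<open>m\<close> and
  \<open>w\<close> are positive, the remaining weight \<open>n - w * m\<close> is smaller than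
  \<open>n\<close>.\<close>

lemma card_flags_above:
  assumes "isotropic s B U"
  shows "card (flags_above U n) = (if n = 0 then 1 else 0) +
    (\<Sum>m\<in>{dim U<..n}. \<Sum>w\<in>{w. 0 < w \<and> w * m \<le> n}. \<Sum>V\<in>extensions U m.
       card (flags_above V (n - w * m)))"
proof -
  define I where "I = (SIGMA m:{dim U<..n}. SIGMA w:{w. 0 < w \<and> w * m \<le> n}. extensions U m)"
  define C where "C = (\<lambda>(m, w, V). Cons (V, w) ` flags_above V (n - w * m))"
  have fin: "finite {w. 0 < w \<and> w * m \<le> n}" if "m > 0" for m
  proof (rule finite_subset)
    show "{w. 0 < w \<and> w * m \<le> n} \<subseteq> {..n}"
      using that
      by auto (metis One_nat_def Suc_leI mult.right_neutral mult_le_mono2 order_trans)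
  qed simp
  have finI: "finite I"
    unfolding I_def by (intro finite_SigmaI) (auto intro: fin)
  have "flags_above U n = (if n = 0 then {[]} else {}) \<union> (\<Union>i\<in>I. C i)"
  proof (intro equalityI subsetI)
    fix F assume F: "F \<in> flags_above U n"
    show "F \<in> (if n = 0 then {[]} else {}) \<union> (\<Union>i\<in>I. C i)"
    proof (cases F)
      case Nil
      with F show ?thesis by (auto simp: flags_above_def flag_weight_def)
    next
      case (Cons a F')
      obtain V w where a: "a = (V, w)" by (cases a)
      from F Cons a have *: "isotropic s B V" "U \<subset> V" "w > 0" "w * dim V \<le> n"
        "F' \<in> flags_above V (n - w * dim V)"
        by (auto simp: Cons_mem_flags_above_iff)
      have "dim U < dim V"
        using * assms extensions_empty[OF assms, of "dim V"] extensions_dim[OF assms]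
        by (cases "dim V" "dim U" rule: linorder_cases) (auto simp: extensions_def)
      moreover have "dim V \<le> n"
        using *(3,4) by (metis One_nat_def Suc_leI mult_le_mono1 nat_mult_1 order_trans)
      ultimately have "(dim V, w, V) \<in> I"
        using * by (auto simp: I_def extensions_def)
      moreover have "F \<in> C (dim V, w, V)"
        using Cons a * by (auto simp: C_def)
      ultimately show ?thesis by blast
    qed
  next
    fix F assume "F \<in> (if n = 0 then {[]} else {}) \<union> (\<Union>i\<in>I. C i)"
    then consider "n = 0" "F = []" | m w V where "(m, w, V) \<in> I" "F \<in> C (m, w, V)"
      by (auto split: if_splits)
    then show "F \<in> flags_above U n"
    proof cases
      case 1
      then show ?thesis by (auto simp: flags_above_def flag_weight_def weighted_flags_def)
    next
      case 2
      \<comment> \<open>Both hold because \<open>dim V = m > dim U\<close>.\<close>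
      have "V \<noteq> {0} \<and> U \<noteq> V"
        using 2(1) dim_eq_iff_card_eq[of "{0}" 0] isotropic_zero
        by (auto simp: I_def extensions_def isotropic_iff)
      with 2 show ?thesis
        by (auto simp: C_def I_def extensions_def Cons_mem_flags_above_iff)
    qed
  qed
  moreover have "card ((if n = 0 then {[]} else {}) \<union> (\<Union>i\<in>I. C i)) =
      card (if n = 0 then {[]} else {} :: ('v set \<times> nat) list set) + card (\<Union>i\<in>I. C i)"
    by (rule card_Un_disjoint)
       (use finI in \<open>auto simp: C_def finite_flags_above split: if_splits\<close>)
  moreover have "card (\<Union>i\<in>I. C i) = (\<Sum>i\<in>I. card (C i))"
    by (rule card_UN_disjoint)
       (use finI in \<open>auto simp: C_def I_def extensions_def finite_flags_above\<close>)
  moreover have "(\<Sum>i\<in>I. card (C i)) = (\<Sum>(m, w, V)\<in>I. card (flags_above V (n - w * m)))"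
    by (rule sum.cong) (auto simp: C_def card_image)
  moreover have "\<dots> = (\<Sum>m\<in>{dim U<..n}. \<Sum>w\<in>{w. 0 < w \<and> w * m \<le> n}. \<Sum>V\<in>extensions U m.
       card (flags_above V (n - w * m)))"
    by (simp add: I_def sum.Sigma fin finite_cartesian_product)
  ultimately show ?thesis by simp
qed

text \<open>Each flag adds 1 to the coefficient at its weight, and only finitely many flags share a
  weight. Equality of two series thus reduces to equality of these cardinalities.\<close>

lemma weighted_flag_series_conv_card:
  "weighted_flag_series s B =
     Abs_fps (\<lambda>n. int (card {F \<in> weighted_flags s B. flag_weight s F = n}))"
  unfolding weighted_flag_series_def
proof (rule infsumI, rule has_sum_fpsI)
  fix n
  have eq: "{F \<in> weighted_flags s B. fps_nth (fps_X ^ flag_weight s F :: int fps) n \<noteq> 0} =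
      {F \<in> weighted_flags s B. flag_weight s F = n}"
    by (auto simp: fps_X_power_nth)
  show "finite {F \<in> weighted_flags s B. fps_nth (fps_X ^ flag_weight s F :: int fps) n \<noteq> 0}"
    unfolding eq by (rule finite_weighted_flags_weight[OF vector_space_axioms])
  show "fps_nth (Abs_fps (\<lambda>n. int (card {F \<in> weighted_flags s B. flag_weight s F = n}))) n =
      (\<Sum>F | F \<in> weighted_flags s B \<and> fps_nth (fps_X ^ flag_weight s F :: int fps) n \<noteq> 0.
         fps_nth (fps_X ^ flag_weight s F) n)"
    unfolding eq by (simp add: fps_X_power_nth)
qed

end

section \<open>Comparison of two spaces with equal extension counts\<close>

text \<open>The common constant \<open>e\<close> is the only link between the two forms: it makes
  the number of enlarging vectors a function of \<open>card U\<close>, hence of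
  \<open>dim U\<close>.\<close>

locale equinumerous_isotropic_vectors =
  V: finite_reflexive_space s B + W: finite_reflexive_space s' B'
  for s :: "'k::{field, finite} \<Rightarrow> 'v::{ab_group_add, finite} \<Rightarrow> 'v" and B
    and s' :: "'k \<Rightarrow> 'w::{ab_group_add, finite} \<Rightarrow> 'w" and B' +
  fixes e :: nat
  assumes card_vectors_V:
      "isotropic s B U \<Longrightarrow> card {x. isotropic s B (V.span (insert x U))} * card U = e"
    and card_vectors_W:
      "isotropic s' B' U' \<Longrightarrow> card {x. isotropic s' B' (W.span (insert x U'))} * card U' = e"
begin

text \<open>Induction on the codimension \<open>m - V.dim U\<close>:
  \<open>card_extensions_rec\<close> expresses both sides through subspaces one dimension
  larger.\<close>

lemma card_extensions_eq:
  assumes "isotropic s B U" "isotropic s' B' U'" "V.dim U = W.dim U'"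
  shows "card (V.extensions U m) = card (W.extensions U' m)"
  using assms
proof (induction "m - V.dim U" arbitrary: U U')
  case 0
  \<comment> \<open>Truncated subtraction puts two situations here: exactly one extension, or
    none.\<close>
  then consider "m = V.dim U" | "m < V.dim U" by linarith
  then show ?case
  proof cases
    case 1
    then show ?thesis
      using V.extensions_dim[OF "0.prems"(1)] W.extensions_dim[OF "0.prems"(2)] "0.prems"(3) by simp
  next
    case 2
    then show ?thesis using 0 V.extensions_empty W.extensions_empty by simp
  qed
next
  case (Suc j)
  define E where "E = {x. isotropic s B (V.span (insert x U))}"
  define E' where "E' = {x. isotropic s' B' (W.span (insert x U'))}"
  have sub: "V.subspace U" "W.subspace U'"
    using Suc.prems by (auto simp: isotropic_def)
  have cardU: "card U = card U'" "card U > 0"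
    using V.card_subspace[OF sub(1)] W.card_subspace[OF sub(2)] Suc.prems(3) by simp_all
  have "card E * card U = card E' * card U'"
    using card_vectors_V[OF Suc.prems(1)] card_vectors_W[OF Suc.prems(2)]
    by (simp add: E_def E'_def)
  then have "card E = card E'" using cardU by auto
  moreover have "U \<subseteq> E"
    using Suc.prems(1) by (auto simp: E_def insert_absorb V.span_eq_iff[THEN iffD2, OF sub(1)])
  moreover have "U' \<subseteq> E'"
    using Suc.prems(2) by (auto simp: E'_def insert_absorb W.span_eq_iff[THEN iffD2, OF sub(2)])
  ultimately have "card (E - U) = card (E' - U')"
    using cardU by (simp add: card_Diff_subset)
  \<comment> \<open>An arbitrary bijection suffices, as the induction hypothesis depends only on
    dimensions.\<close>
  then obtain h where h: "bij_betw h (E - U) (E' - U')"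
    using finite_same_card_bij[OF finite finite] by blast
  have "(\<Sum>x\<in>E - U. card (V.extensions (V.span (insert x U)) m)) =
      (\<Sum>x\<in>E - U. card (W.extensions (W.span (insert (h x) U')) m))"
  proof (rule sum.cong)
    fix x assume x: "x \<in> E - U"
    then have hx: "h x \<in> E' - U'" using h by (auto dest: bij_betwE)
    have "V.dim (V.span (insert x U)) = Suc (V.dim U)"
      "W.dim (W.span (insert (h x) U')) = Suc (W.dim U')"
      using x hx V.dim_span_insert[OF sub(1)] W.dim_span_insert[OF sub(2)] by blast+
    then show "card (V.extensions (V.span (insert x U)) m) =
        card (W.extensions (W.span (insert (h x) U')) m)"
      using x hx Suc.hyps(2) Suc.prems(3)
      by (intro Suc.hyps(1)) (auto simp: E_def E'_def simp del: V.dim_span W.dim_span)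
  qed simp
  also have "\<dots> = (\<Sum>x\<in>E' - U'. card (W.extensions (W.span (insert x U')) m))"
    by (rule sum.reindex_bij_betw[OF h])
  finally have "card (V.extensions U m) * (CARD('k) ^ m - CARD('k) ^ V.dim U) =
      card (W.extensions U' m) * (CARD('k) ^ m - CARD('k) ^ V.dim U)"
    using V.card_extensions_rec[OF Suc.prems(1), of m] W.card_extensions_rec[OF Suc.prems(2), of m]
      Suc.prems(3) by (simp add: E_def E'_def)
  \<comment> \<open>Strictness makes the common factor positive, so it can be cancelled.\<close>
  moreover have "CARD('k) ^ V.dim U < CARD('k) ^ m"
    using Suc.hyps(2) card_field_gt_1[where 'k = 'k] by (intro power_strict_increasing) auto
  ultimately show ?case by simp
qed

text \<open>Strong induction on the weight: in \<open>card_flags_above\<close> the first steps of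
  each dimension are equinumerous by \<open>card_extensions_eq\<close>, and the remaining flags have
  smaller weight.\<close>

lemma card_flags_above_eq:
  assumes "isotropic s B U" "isotropic s' B' U'" "V.dim U = W.dim U'"
  shows "card (V.flags_above U n) = card (W.flags_above U' n)"
  using assms
proof (induction n arbitrary: U U' rule: less_induct)
  case (less n)
  have "(\<Sum>X\<in>V.extensions U m. card (V.flags_above X (n - w * m))) =
      (\<Sum>X\<in>W.extensions U' m. card (W.flags_above X (n - w * m)))"
    if "m \<in> {V.dim U<..n}" "w \<in> {w. 0 < w \<and> w * m \<le> n}" for m w
  proof -
    obtain h where h: "bij_betw h (V.extensions U m) (W.extensions U' m)"
      using finite_same_card_bij[OF finite finite card_extensions_eq[OF less.prems]] by blast
    have "(\<Sum>X\<in>V.extensions U m. card (V.flags_above X (n - w * m))) =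
        (\<Sum>X\<in>V.extensions U m. card (W.flags_above (h X) (n - w * m)))"
    proof (rule sum.cong)
      fix X assume X: "X \<in> V.extensions U m"
      then have "h X \<in> W.extensions U' m" using h by (auto dest: bij_betwE)
      with X that show "card (V.flags_above X (n - w * m)) = card (W.flags_above (h X) (n - w * m))"
        by (intro less.IH) (auto simp: V.extensions_def W.extensions_def)
    qed simp
    also have "\<dots> = (\<Sum>X\<in>W.extensions U' m. card (W.flags_above X (n - w * m)))"
      by (rule sum.reindex_bij_betw[OF h])
    finally show ?thesis .
  qed
  then show ?case
    using less.prems(3)
    by (simp add: V.card_flags_above[OF less.prems(1)] W.card_flags_above[OF less.prems(2)])
qed

lemma weighted_flag_series_eq: "weighted_flag_series s B = weighted_flag_series s' B'"
proof -
  have "V.dim {0} = 0" "W.dim {0} = 0"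
    using V.isotropic_zero W.isotropic_zero V.dim_eq_iff_card_eq W.dim_eq_iff_card_eq
    by (auto simp: isotropic_def)
  then show ?thesis
    using card_flags_above_eq[OF V.isotropic_zero W.isotropic_zero]
    by (simp add: V.weighted_flag_series_conv_card W.weighted_flag_series_conv_card
        V.flags_above_zero W.flags_above_zero)
qed

end

section \<open>The symplectic and the quadratic space share the constant
  \<open>CARD('k) ^ (2 * d)\<close>\<close>

theorem theorem3p3:
  fixes q d :: nat
    and scaleV :: "'k::{field, finite} \<Rightarrow> 'v::{ab_group_add, finite} \<Rightarrow> 'v"
    and scaleW :: "'k \<Rightarrow> 'w::{ab_group_add, finite} \<Rightarrow> 'w"
    and \<omega> :: "'v \<Rightarrow> 'v \<Rightarrow> 'k"
    and Q :: "'w \<Rightarrow> 'k"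
  assumes "primepow q" and "odd q" and "CARD('k) = q"
    and "vector_space scaleV" and "vector_space.dim scaleV (UNIV :: 'v set) = 2 * d"
    and "symplectic_form scaleV \<omega>"
    and "vector_space scaleW" and "vector_space.dim scaleW (UNIV :: 'w set) = 2 * d + 1"
    and "quadratic_form scaleW Q" and "nondegenerate (polar Q)"
    and "\<exists>U. isotropic scaleW (polar Q) U \<and> vector_space.dim scaleW U = d"
  shows "weighted_flag_series scaleV \<omega> = weighted_flag_series scaleW (polar Q)"
proof -
  interpret V: finite_reflexive_space scaleV \<omega>
  proof (intro finite_reflexive_space.intro finite_reflexive_space_axioms.intro)
    show "vector_space scaleV" "bilinear_form scaleV \<omega>"
      using assms by (simp_all add: symplectic_form_def)
    fix x y assume "\<omega> x y = 0"
    \<comment> \<open>Polarization: the three diagonal values vanish, so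
      \<open>\<omega> y x = - \<omega> x y\<close>.\<close>
    moreover have "\<omega> (x + y) (x + y) = \<omega> x x + \<omega> x y + (\<omega> y x + \<omega> y y)"
      using \<open>bilinear_form scaleV \<omega>\<close> by (simp add: bilinear_form_def Vector_Spaces.linear_iff)
    ultimately show "\<omega> y x = 0"
      using assms(6) by (simp add: symplectic_form_def)
  qed
  have sym: "polar Q x y = polar Q y x" for x y
    by (simp add: polar_def add.commute)
  interpret W: finite_reflexive_space scaleW "polar Q"
    by (intro finite_reflexive_space.intro finite_reflexive_space_axioms.intro)
       (use assms sym in \<open>auto simp: quadratic_form_def\<close>)
  obtain M where M: "isotropic scaleW (polar Q) M" "W.dim M = d"
    using assms(11) by blast
  have cardW: "CARD('w) = CARD('k) * (card M)\<^sup>2"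
    using W.card_subspace[OF W.subspace_UNIV] W.card_subspace[of M] M assms(8)
    by (simp add: isotropic_def power_mult mult.commute flip: power_mult)
  have two: "(2 :: 'k) \<noteq> 0"
    using assms(2,3) by (intro two_neq_zero_if_odd_card) simp
  interpret equinumerous_isotropic_vectors scaleV \<omega> scaleW "polar Q" "CARD('k) ^ (2 * d)"
  proof
    fix U assume "isotropic scaleV \<omega> U"
    then show "card {x. isotropic scaleV \<omega> (V.span (insert x U))} * card U = CARD('k) ^ (2 * d)"
      using V.card_isotropic_vectors_alternating V.card_subspace[OF V.subspace_UNIV] assms(5,6)
      by (simp add: symplectic_form_def)
  next
    fix U assume U: "isotropic scaleW (polar Q) U"
    \<comment> \<open>The factor lost to the \<open>1/q\<close> fraction of isotropic vectors is
      exactly the one gained from the extra dimension.\<close>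
    have "CARD('k) * (card {x. isotropic scaleW (polar Q) (W.span (insert x U))} * card U) =
        CARD('k) * CARD('k) ^ (2 * d)"
      using W.card_isotropic_vectors_symmetric[OF assms(10) sym two M(1) cardW U]
        W.card_subspace[OF W.subspace_UNIV] assms(8) by simp
    then show "card {x. isotropic scaleW (polar Q) (W.span (insert x U))} * card U =
        CARD('k) ^ (2 * d)"
      by simp
  qed
  show ?thesis by (rule weighted_flag_series_eq)
qed

end
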